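(* Let $\mathcal C$ be a cube and $O_1,O_2$ two opposite vertices of it. Let $L=V_0V_1\dots V_5V_0$ be the closed polygonal line formed by edges of $\mathcal C$ passing through the remaining six vertices (indices mod $6$), so that $\mathcal C$ is the union of the six simplices $O_1O_2V_kV_{k+1}$, $k=0,\dots,5$ (the diagonal split). Let $S$ be the union of the six edges adjacent to $O_1$ or $O_2$, and $P$ the union of the six face diagonals adjacent to $O_1$ or $O_2$. If $f\colon\mathcal C\to\mathbb{R}$ is convex on each simplex $O_1O_2V_kV_{k+1}$, then $$\operatorname{Avg}(f,\mathcal C)\le\frac12\operatorname{Avg}(f,O_1O_2)+\frac12\operatorname{Avg}(f,L),\qquad \operatorname{Avg}(f,\mathcal C)\le\operatorname{Avg}(f,P),\qquad \operatorname{Avg}(f,\mathcal C)\le\operatorname{Avg}(f,S).$$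
   Context: $\operatorname{Avg}(f,\mathcal C)$ is the average over the cube with respect to volume; $\operatorname{Avg}(f,O_1O_2)$ is the average over the segment $O_1O_2$, and $\operatorname{Avg}(f,L)$, $\operatorname{Avg}(f,P)$, $\operatorname{Avg}(f,S)$ are averages over these unions of segments, all with respect to length. *)

theory Defs
  imports "HOL-Analysis.Analysis"
begin

text \<open>Cube spanned at vertex a by pairwise orthogonal edge vectors e1 e2 e3 of equal nonzero length.\<close>
definition cube_set :: "real^3 \<Rightarrow> real^3 \<Rightarrow> real^3 \<Rightarrow> real^3 \<Rightarrow> (real^3) set" where
  "cube_set a e1 e2 e3 =
     {a + x1 *\<^sub>R e1 + x2 *\<^sub>R e2 + x3 *\<^sub>R e3 | x1 x2 x3.
        x1 \<in> {0..1} \<and> x2 \<in> {0..1} \<and> x3 \<in> {0..1}}"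

definition vol_avg :: "(real^3 \<Rightarrow> real) \<Rightarrow> (real^3) set \<Rightarrow> real" where
  "vol_avg f C = integral C f / measure lebesgue C"

definition seg_avg :: "('a::real_normed_vector \<Rightarrow> real) \<Rightarrow> 'a \<Rightarrow> 'a \<Rightarrow> real" where
  "seg_avg f p q = integral {0..1} (\<lambda>t. f (p + t *\<^sub>R (q - p)))"

text \<open>Average with respect to length over a union of segments meeting only in finitely many
  points: length-weighted mean of the segment averages.\<close>
definition union_avg :: "('a::real_normed_vector \<Rightarrow> real) \<Rightarrow> ('a \<times> 'a) list \<Rightarrow> real" where
  "union_avg f segs =
     (\<Sum>(p,q)\<leftarrow>segs. dist p q * seg_avg f p q) / (\<Sum>(p,q)\<leftarrow>segs. dist p q)"

end

theory Submission
  imports Defs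
begin

text \<open>
  A uniformly distributed point of a simplex \<open>ABCD\<close> can be written \<open>(1 - s) Y + s Z\<close> with \<open>Y\<close> uniform on
  \<open>AB\<close>, \<open>Z\<close> uniform on the opposite edge \<open>CD\<close>, and \<open>s\<close> independent of both with density \<open>6 s (1 - s)\<close>.
  Convexity gives \<open>f ((1 - s) Y + s Z) \<le> (1 - s) f Y + s f Z\<close>, and as \<open>s\<close> has mean \<open>1/2\<close>, the average
  of \<open>f\<close> over the simplex is at most the mean of its averages over two opposite edges. Each simplex
  \<open>O\<^sub>1O\<^sub>2V\<^sub>kV\<^sub>k\<^sub>+\<^sub>1\<close> has three pairs of opposite edges: the diagonal and an edge of \<open>L\<close>, two segments of \<open>P\<close>,
  two segments of \<open>S\<close>. Averaging each of the three inequalities over the six simplices, which have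
  equal volume, proves the theorem.
\<close>

subsection \<open>Integrability of convex functions\<close>

text \<open>Pushing any point of \<open>S\<close> through \<open>c\<close> by one fixed factor keeps
  it in \<open>S\<close>, where \<open>f\<close> is at most \<open>M\<close>; as \<open>c\<close>
  lies in between, \<open>f c\<close> bounds \<open>f x\<close> from below, uniformly in
  \<open>x\<close>.\<close>

lemma convex_on_bounded_below:
  fixes f :: "'a::real_normed_vector \<Rightarrow> real"
  assumes conv: "convex_on S f" and bdd: "bounded S" and c: "c \<in> interior S"
    and le: "\<And>x. x \<in> S \<Longrightarrow> f x \<le> M"
  shows "\<exists>m. \<forall>x\<in>S. m \<le> f x"
proof -
  obtain e where e: "e > 0" "ball c e \<subseteq> S"
    using c by (auto simp: mem_interior)
  obtain B where B: "B > 0" "\<And>x. x \<in> S \<Longrightarrow> dist c x \<le> B"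
  proof -
    obtain B where B: "\<And>x. x \<in> S \<Longrightarrow> dist c x \<le> B"
      using bdd unfolding bounded_any_center[where a=c] by blast
    have "dist c x \<le> max B 1" if "x \<in> S" for x
      using B[OF that] by simp
    then show thesis by (intro that[of "max B 1"]) auto
  qed
  \<comment> \<open>The factor gives \<open>t * B = e / 2 < e\<close>, so the same \<open>t\<close>
    serves every \<open>x\<close>.\<close>
  define t where "t = e / (2 * B)"
  have t: "t > 0" using e B by (simp add: t_def)
  show ?thesis
  proof (intro exI ballI)
    fix x assume x: "x \<in> S"
    \<comment> \<open>Pushing \<open>x\<close> through \<open>c\<close> lands in the ball, so \<open>c\<close> is a convex combination of \<open>x\<close> and \<open>y\<close>.\<close>
    define y where "y = c + t *\<^sub>R (c - x)"
    have "dist c y = t * dist c x"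
      using t by (simp add: y_def dist_norm)
    also have "\<dots> \<le> t * B" using B(2)[OF x] t by simp
    also have "\<dots> < e" using e B by (simp add: t_def)
    finally have y: "y \<in> S" using e by auto
    have ceq: "c = (t / (1 + t)) *\<^sub>R x + (1 / (1 + t)) *\<^sub>R y"
    proof -
      have "t *\<^sub>R x + y = (1 + t) *\<^sub>R c"
        by (simp add: y_def algebra_simps)
      then have "(1 / (1 + t)) *\<^sub>R (t *\<^sub>R x + y) = c" using t by simp
      then show ?thesis by (simp add: scaleR_add_right)
    qed
    have "f ((t / (1 + t)) *\<^sub>R x + (1 / (1 + t)) *\<^sub>R y) \<le> t / (1 + t) * f x + 1 / (1 + t) * f y"
      using t by (intro conv[unfolded convex_on_def, THEN conjunct2, rule_format] x y)
        (auto simp: add_divide_distrib[symmetric])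
    then have "f c \<le> t / (1 + t) * f x + 1 / (1 + t) * f y"
      using ceq by simp
    also have "\<dots> \<le> t / (1 + t) * f x + 1 / (1 + t) * M"
      using le[OF y] t by (intro add_left_mono mult_left_mono) auto
    also have "\<dots> = (t * f x + M) / (1 + t)"
      by (simp add: add_divide_distrib)
    finally show "((1 + t) * f c - M) / t \<le> f x"
      using t by (simp add: field_simps)
  qed
qed

text \<open>In the interior \<open>f\<close> is continuous and bounded on both sides. The rest of
  \<open>S\<close>, where \<open>f\<close> may jump, lies in the frontier, which is negligible for a
  convex set.\<close>

lemma convex_on_absolutely_integrable:
  fixes f :: "'a::euclidean_space \<Rightarrow> real"
  assumes conv: "convex_on S f" and bdd: "bounded S"
    and le: "\<And>x. x \<in> S \<Longrightarrow> f x \<le> M"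
  shows "f absolutely_integrable_on S"
proof -
  have cS: "convex S" using conv convex_on_imp_convex by blast
  have *: "f absolutely_integrable_on interior S"
  proof (cases "interior S = {}")
    case False
    then obtain c where "c \<in> interior S" by blast
    then obtain m where m: "\<And>x. x \<in> S \<Longrightarrow> m \<le> f x"
      using convex_on_bounded_below[OF conv bdd _ le] by blast
    have cont: "continuous_on (interior S) f"
      using convex_on_continuous[OF open_interior convex_on_subset[OF conv interior_subset]] cS
      by (simp add: convex_interior)
    show ?thesis
    proof (rule measurable_bounded_by_integrable_imp_absolutely_integrable)
      show "f \<in> borel_measurable (lebesgue_on (interior S))"
        using cont by (intro continuous_imp_measurable_on_sets_lebesgue) auto
      show "(\<lambda>x. \<bar>m\<bar> + \<bar>M\<bar>) integrable_on interior S"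
        using bdd by (intro integrable_on_const lmeasurable_open) (auto intro: bounded_interior)
      show "norm (f x) \<le> \<bar>m\<bar> + \<bar>M\<bar>" if "x \<in> interior S" for x
        using m[of x] le[of x] that interior_subset by fastforce
    qed simp
  qed auto
  have "negligible (S - interior S)"
    using negligible_convex_frontier[OF cS]
    by (rule negligible_subset) (auto simp: frontier_def intro: closure_subset[THEN subsetD])
  then have "negligible {x \<in> S - interior S. f x \<noteq> 0}"
    by (rule negligible_subset) auto
  moreover have "negligible {x \<in> interior S - S. f x \<noteq> 0}"
    by (rule negligible_subset[of "{}"]) (use interior_subset in auto)
  ultimately show ?thesis
    using * absolutely_integrable_spike_set_eq[of S "interior S" f] by blast
qed

section \<open>Integrals of product functions over the unit box\<close>

text \<open>Fubini for products: \<open>lborel_eq\<close> presents the measure as the image of a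
  product measure indexed by \<open>Basis\<close>, and the basis of \<open>real^'n\<close> is
  reindexed by its coordinates.\<close>

lemma lborel_vec_prod:
  fixes g :: "'n::finite \<Rightarrow> real \<Rightarrow> real"
  assumes g: "\<And>i. integrable lborel (g i)"
  shows "integrable lborel (\<lambda>x::real^'n. \<Prod>i\<in>UNIV. g i (x $ i))"
    and "(\<integral>x. (\<Prod>i\<in>UNIV. g i ((x::real^'n) $ i)) \<partial>lborel) = (\<Prod>i\<in>UNIV. \<integral>t. g i t \<partial>lborel)"
proof -
  interpret product_sigma_finite "\<lambda>b::real^'n. lborel :: real measure" ..
  have [measurable]: "g i \<in> borel_measurable borel" for i
    using borel_measurable_integrable[OF g[of i]] by simp
  \<comment> \<open>\<open>F\<close> carries the factors from coordinates \<open>i\<close> over to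
    basis vectors \<open>axis i 1\<close>.\<close>
  define F where "F b = g (THE i. b = axis i 1)" for b :: "real^'n"
  have F: "F (axis i 1) = g i" for i
    by (simp add: F_def axis_eq_axis)
  have B: "(Basis :: (real^'n) set) = range (\<lambda>i. axis i 1)"
    by (auto simp: Basis_vec_def)
  have inj: "inj (\<lambda>i::'n. axis i (1::real))"
    by (auto simp: inj_on_def axis_eq_axis)
  have prod_Basis: "(\<Prod>b\<in>(Basis :: (real^'n) set). h b) = (\<Prod>i\<in>UNIV. h (axis i 1))"
    for h :: "real^'n \<Rightarrow> real"
    unfolding B by (simp add: prod.reindex[OF inj] o_def)
  have comp: "(\<Sum>b\<in>Basis. x b *\<^sub>R b) $ i = x (axis i 1)" for x :: "real^'n \<Rightarrow> real" and i
    by (subst cart_eq_inner_axis) (simp add: axis_in_Basis_iff inner_sum_left_Basis)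
  have FI: "integrable lborel (F b)" if "b \<in> Basis" for b
    using that g by (auto simp: B F)
  have P: "(\<lambda>x. \<Prod>i\<in>UNIV. g i ((\<Sum>b\<in>Basis. x b *\<^sub>R b) $ i))
      = (\<lambda>x. \<Prod>b\<in>(Basis :: (real^'n) set). F b (x b))"
    by (simp only: prod_Basis F comp)
  have m: "(\<lambda>x::real^'n. \<Prod>i\<in>UNIV. g i (x $ i)) \<in> borel_measurable borel"
    by measurable
  have m2: "(\<lambda>x. \<Sum>b\<in>Basis. x b *\<^sub>R b) \<in> measurable (\<Pi>\<^sub>M b\<in>(Basis :: (real^'n) set). lborel) borel"
    by measurable
  show "integrable lborel (\<lambda>x::real^'n. \<Prod>i\<in>UNIV. g i (x $ i))"
    by (subst lborel_eq, subst integrable_distr_eq[OF m2 m], subst P)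
       (rule product_integrable_prod[OF finite_Basis FI])
  show "(\<integral>x. (\<Prod>i\<in>UNIV. g i ((x::real^'n) $ i)) \<partial>lborel) = (\<Prod>i\<in>UNIV. \<integral>t. g i t \<partial>lborel)"
    by (subst lborel_eq, subst integral_distr[OF m2 m], subst P,
        subst product_integral_prod[OF finite_Basis FI]) (simp_all add: prod_Basis F)
qed

text \<open>Every coordinate other than \<open>i\<close> and \<open>j\<close> gets the constant
  factor 1, of integral 1. Only the open interval appears because a convex function on the closed
  one may jump at its ends.\<close>

lemma has_integral_unit_box_prod2:
  fixes w \<phi> :: "real \<Rightarrow> real" and i j :: "'n::finite"
  assumes ij: "i \<noteq> j"
    and w: "continuous_on {0<..<1} w" "w absolutely_integrable_on {0<..<1}"
    and \<phi>: "continuous_on {0<..<1} \<phi>" "\<phi> absolutely_integrable_on {0<..<1}"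
  shows "((\<lambda>x::real^'n. w (x $ i) * \<phi> (x $ j)) has_integral
      integral {0<..<1} w * integral {0<..<1} \<phi>) (box 0 1)"
proof -
  define h where "h k = (if k = i then w else if k = j then \<phi> else (\<lambda>_. 1))" for k
  define g where "g k t = indicator {0<..<1} t *\<^sub>R h k t" for k :: 'n and t :: real
  have hc: "continuous_on {0<..<1} (h k)" and hi: "h k absolutely_integrable_on {0<..<1}" for k
    using w \<phi> by (auto simp: h_def)
  have gm: "g k \<in> borel_measurable borel" for k
    unfolding g_def by (intro borel_measurable_continuous_on_indicator hc) auto
  have gl: "integrable lebesgue (g k)" for k
    using hi[of k] by (simp add: set_integrable_def g_def[abs_def])
  \<comment> \<open>Continuity on the open interval makes \<open>g k\<close> Borel, so integrability
    descends from the completion to \<open>lborel\<close>.\<close>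
  have gi: "integrable lborel (g k)" for k
    using gl[of k] gm[of k] by (subst (asm) integrable_completion) auto
  have gint: "(\<integral>t. g k t \<partial>lborel) = integral {0<..<1} (h k)" for k
  proof -
    have "(\<integral>t. g k t \<partial>lborel) = (\<integral>t. g k t \<partial>lebesgue)"
      using gm[of k] by (simp add: integral_completion)
    also have "\<dots> = integral {0<..<1} (h k)"
      using set_lebesgue_integral_eq_integral(2)[OF hi[of k]]
      by (simp add: set_lebesgue_integral_def g_def)
    finally show ?thesis .
  qed
  have one: "integral {0<..<1::real} (\<lambda>_. 1::real) = 1"
    using integral_open_interval_real[of 0 1 "\<lambda>_. 1::real"] by simp
  have split: "(\<Prod>k\<in>UNIV. a k) = a i * a j * (\<Prod>k\<in>UNIV - {i,j}. a k)" for a :: "'n \<Rightarrow> real"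
    using ij by (subst prod.subset_diff[of "{i,j}"]) auto
  have "(\<Prod>k\<in>UNIV. integral {0<..<1} (h k)) = integral {0<..<1} w * integral {0<..<1} \<phi>"
    using ij by (subst split) (simp add: h_def one prod.neutral)
  moreover have "(\<Prod>k\<in>UNIV. g k (x $ k)) = (if x \<in> box 0 1 then w (x $ i) * \<phi> (x $ j) else 0)"
    for x :: "real^'n"
  proof (cases "x \<in> box 0 1")
    case True
    then have "0 < x $ k" "x $ k < 1" for k by (auto simp: mem_box_cart)
    then have "g k (x $ k) = h k (x $ k)" for k by (simp add: g_def)
    then show ?thesis using True ij by (subst split) (simp add: h_def)
  next
    case False
    then obtain k where "\<not> (0 < x $ k \<and> x $ k < 1)" by (auto simp: mem_box_cart)
    then have "g k (x $ k) = 0" by (auto simp: g_def)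
    then show ?thesis using False by (auto intro: prod_zero)
  qed
  moreover have "((\<lambda>x::real^'n. \<Prod>k\<in>UNIV. g k (x $ k)) has_integral
      (\<Prod>k\<in>UNIV. integral {0<..<1} (h k))) UNIV"
    using has_integral_integral_lborel[OF lborel_vec_prod(1)[of g, OF gi]]
    by (simp only: lborel_vec_prod(2)[of g, OF gi] gint)
  ultimately show ?thesis by (simp add: has_integral_restrict_UNIV)
qed

subsection \<open>Averages over opposite edges of a simplex\<close>

text \<open>The vector-valued change of variables theorem, with real values read as vectors in
  \<open>real^1\<close>.\<close>

lemma change_of_variables_real_valued:
  fixes f :: "real^'m::{finite,wellorder} \<Rightarrow> real" and g :: "real^'m::_ \<Rightarrow> real^'m::_"
  assumes S: "S \<in> sets lebesgue"
    and der_g: "\<And>x. x \<in> S \<Longrightarrow> (g has_derivative g' x) (at x within S)"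
    and inj: "inj_on g S"
    and f: "f absolutely_integrable_on (g ` S)"
  shows "(\<lambda>x. \<bar>det (matrix (g' x))\<bar> * f (g x)) absolutely_integrable_on S"
    and "integral S (\<lambda>x. \<bar>det (matrix (g' x))\<bar> * f (g x)) = integral (g ` S) f"
proof -
  define b where "b = integral (g ` S) f"
  have "(\<lambda>x. \<bar>det (matrix (g' x))\<bar> *\<^sub>R vec (f (g x)) :: real^1) absolutely_integrable_on S \<and>
      integral S (\<lambda>x. \<bar>det (matrix (g' x))\<bar> *\<^sub>R vec (f (g x))) = (vec b :: real^1)
    \<longleftrightarrow> (\<lambda>x. vec (f x) :: real^1) absolutely_integrable_on (g ` S) \<and>
      integral (g ` S) (\<lambda>x. vec (f x)) = (vec b :: real^1)"
    by (intro has_absolute_integral_change_of_variables assms)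
  then show "(\<lambda>x. \<bar>det (matrix (g' x))\<bar> * f (g x)) absolutely_integrable_on S"
    and "integral S (\<lambda>x. \<bar>det (matrix (g' x))\<bar> * f (g x)) = integral (g ` S) f"
    using f by (auto simp: absolutely_integrable_on_1_iff integral_on_1_eq b_def)
qed

text \<open>Cramer's rule: combining the three coordinate equations with cofactors leaves each
  coefficient times the determinant.\<close>

lemma det_vector_3_independent:
  fixes p q r :: "real^3"
  assumes d: "det (vector [p, q, r] :: real^3^3) \<noteq> 0"
    and eq: "\<alpha> *\<^sub>R p + \<beta> *\<^sub>R q + \<gamma> *\<^sub>R r = 0"
  shows "\<alpha> = 0" "\<beta> = 0" "\<gamma> = 0"
proof -
  define d where "d = det (vector [p, q, r] :: real^3^3)"
  have e: "\<alpha> * p $ i + \<beta> * q $ i + \<gamma> * r $ i = 0" for i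
    using arg_cong[OF eq, of "\<lambda>v. v $ i"] by simp
  note e = e[of 1] e[of 2] e[of 3]
  have "\<alpha> * d = 0" "\<beta> * d = 0" "\<gamma> * d = 0"
    unfolding d_def det_3 vector_3 using e by algebra+
  then show "\<alpha> = 0" "\<beta> = 0" "\<gamma> = 0" using d by (auto simp: d_def)
qed

section \<open>Parametrisation of a simplex by two opposite edges\<close>

text \<open>\<open>x $ 2\<close> and \<open>x $ 3\<close> place points on \<open>AB\<close> and
  \<open>CD\<close>; \<open>x $ 1\<close> is the ratio \<open>s\<close> between them. The three
  parameters form one vector so that change of variables applies.\<close>

definition join_map :: "'a::real_vector \<Rightarrow> 'a \<Rightarrow> 'a \<Rightarrow> 'a \<Rightarrow> real^3 \<Rightarrow> 'a" where
  "join_map A B C D x =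
     (1 - x $ 1) *\<^sub>R (A + x $ 2 *\<^sub>R (B - A)) + x $ 1 *\<^sub>R (C + x $ 3 *\<^sub>R (D - C))"

text \<open>The hull of the union of two nonempty convex sets consists of the segments joining them,
  here with the edges \<open>AB\<close> and \<open>CD\<close>.\<close>

lemma convex_hull_eq_join_map:
  fixes A B C D :: "'a::euclidean_space"
  shows "convex hull {A, B, C, D} = join_map A B C D ` cbox 0 1"
proof -
  have "convex hull {A, B, C, D} = convex hull ({A, B} \<union> {C, D})"
    by (simp add: insert_commute)
  also have "\<dots> = convex hull (convex hull {A, B} \<union> convex hull {C, D})"
    by (rule hull_Un) (auto intro: convex_Inter)
  also have "\<dots> = {u *\<^sub>R s + v *\<^sub>R t | u v s t. u \<ge> 0 \<and> v \<ge> 0 \<and> u + v = 1 \<and>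
      s \<in> convex hull {A, B} \<and> t \<in> convex hull {C, D}}"
    by (rule convex_hull_union_two) auto
  also have "\<dots> = join_map A B C D ` cbox 0 1" (is "?L = ?R")
  proof
    show "?L \<subseteq> ?R"
    proof
      fix p assume "p \<in> ?L"
      then obtain u v s t where *: "p = u *\<^sub>R (A + s *\<^sub>R (B - A)) + v *\<^sub>R (C + t *\<^sub>R (D - C))"
        "u \<ge> 0" "v \<ge> 0" "u + v = 1" "0 \<le> s" "s \<le> 1" "0 \<le> t" "t \<le> 1"
        unfolding convex_hull_2_alt by blast
      then have "p = join_map A B C D (vector [v, s, t])" "u = 1 - v"
        by (auto simp: join_map_def)
      moreover have "(vector [v, s, t] :: real^3) \<in> cbox 0 1"
        using * by (auto simp: mem_box_cart forall_3)
      ultimately show "p \<in> ?R" by blast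
    qed
    show "?R \<subseteq> ?L"
      unfolding convex_hull_2_alt
    proof (clarsimp simp: mem_box_cart forall_3)
      fix x :: "real^3"
      assume "0 \<le> x $ 1" "0 \<le> x $ 2" "0 \<le> x $ 3" "x $ 1 \<le> 1" "x $ 2 \<le> 1" "x $ 3 \<le> 1"
      then show "\<exists>u v s t. join_map A B C D x = u *\<^sub>R s + v *\<^sub>R t \<and> 0 \<le> u \<and> 0 \<le> v \<and> u + v = 1 \<and>
        (\<exists>u. s = A + u *\<^sub>R (B - A) \<and> 0 \<le> u \<and> u \<le> 1) \<and> (\<exists>u. t = C + u *\<^sub>R (D - C) \<and> 0 \<le> u \<and> u \<le> 1)"
        by (intro exI[of _ "1 - x $ 1"] exI[of _ "x $ 1"] exI[of _ "A + x $ 2 *\<^sub>R (B - A)"]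
            exI[of _ "C + x $ 3 *\<^sub>R (D - C)"]) (auto simp: join_map_def)
    qed
  qed
  finally show ?thesis .
qed

text \<open>Up to sign, six times the volume of the simplex.\<close>

abbreviation simplex_det :: "real^3 \<Rightarrow> real^3 \<Rightarrow> real^3 \<Rightarrow> real^3 \<Rightarrow> real" where
  "simplex_det A B C D \<equiv> det (vector [B - A, C - A, D - A] :: real^3^3)"

definition join_map_deriv :: "'a::real_vector \<Rightarrow> 'a \<Rightarrow> 'a \<Rightarrow> 'a \<Rightarrow> real^3 \<Rightarrow> real^3 \<Rightarrow> 'a" where
  "join_map_deriv A B C D x h =
     h $ 1 *\<^sub>R ((C + x $ 3 *\<^sub>R (D - C)) - (A + x $ 2 *\<^sub>R (B - A)))
     + h $ 2 *\<^sub>R (1 - x $ 1) *\<^sub>R (B - A) + h $ 3 *\<^sub>R x $ 1 *\<^sub>R (D - C)"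

lemma has_derivative_join_map:
  fixes A B C D :: "'a::real_normed_vector"
  shows "(join_map A B C D has_derivative join_map_deriv A B C D x) (at x within S)"
  unfolding join_map_def[abs_def] join_map_deriv_def[abs_def]
  by (rule derivative_eq_intros bounded_linear.has_derivative[OF bounded_linear_vec_nth] refl
        | simp add: fun_eq_iff algebra_simps)+

text \<open>The partial derivatives are \<open>Z - Y\<close>, \<open>(1 - s) (B - A)\<close> and
  \<open>s (D - C)\<close>, with \<open>Y\<close>, \<open>Z\<close> the points on the two edges.
  Modulo the last two directions \<open>Z - Y\<close> becomes \<open>C - A\<close>. Divided by the
  volume, this is the density \<open>6 s (1 - s)\<close>.\<close>

lemma det_join_map_deriv:
  fixes A B C D :: "real^3"
  shows "\<bar>det (matrix (join_map_deriv A B C D x))\<bar>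
    = \<bar>x $ 1 * (1 - x $ 1)\<bar> * \<bar>simplex_det A B C D\<bar>"
proof -
  have "det (matrix (join_map_deriv A B C D x)) = - (x $ 1 * (1 - x $ 1)) * simplex_det A B C D"
    unfolding det_3 matrix_def join_map_deriv_def by (simp add: axis_def) algebra
  then show ?thesis by (simp add: abs_mult)
qed

text \<open>The coefficients of \<open>B - A\<close>, \<open>C - A\<close>, \<open>D - A\<close> are
  determined by the point. The last two add up to \<open>x $ 1\<close>, and in the open box one may
  divide by \<open>x $ 1\<close> and \<open>1 - x $ 1\<close>.\<close>

lemma inj_on_join_map:
  fixes A B C D :: "real^3"
  assumes d: "simplex_det A B C D \<noteq> 0"
  shows "inj_on (join_map A B C D) (box 0 1)"
proof (rule inj_onI)
  fix x y :: "real^3"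
  assume "x \<in> box 0 1" "y \<in> box 0 1" and eq: "join_map A B C D x = join_map A B C D y"
  then have x: "0 < x $ 1" "x $ 1 < 1" and y: "0 < y $ 1" "y $ 1 < 1"
    by (auto simp: mem_box_cart)
  have "((1 - x $ 1) * x $ 2 - (1 - y $ 1) * y $ 2) *\<^sub>R (B - A)
      + (x $ 1 * (1 - x $ 3) - y $ 1 * (1 - y $ 3)) *\<^sub>R (C - A)
      + (x $ 1 * x $ 3 - y $ 1 * y $ 3) *\<^sub>R (D - A) = join_map A B C D x - join_map A B C D y"
    (is "?lhs = _")
    by (simp add: join_map_def algebra_simps)
  then have "?lhs = 0" using eq by simp
  from det_vector_3_independent[OF d this] have *: "(1 - x $ 1) * x $ 2 = (1 - y $ 1) * y $ 2"
      "x $ 1 * (1 - x $ 3) = y $ 1 * (1 - y $ 3)" "x $ 1 * x $ 3 = y $ 1 * y $ 3"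
    by simp_all
  from *(2,3) have "x $ 1 = y $ 1" by (simp add: algebra_simps)
  with * x y show "x = y" by (simp add: vec_eq_iff forall_3)
qed

section \<open>Convex functions on segments and polytopes\<close>

lemma convex_on_segment:
  fixes f :: "'a::real_vector \<Rightarrow> real"
  assumes conv: "convex_on S f" and "A \<in> S" "B \<in> S"
  shows "convex_on {0..1} (\<lambda>t. f (A + t *\<^sub>R (B - A)))"
proof (rule convex_onI)
  fix t x y :: real
  assume t: "0 < t" "t < 1" and xy: "x \<in> {0..1}" "y \<in> {0..1}"
  have inS: "A + u *\<^sub>R (B - A) \<in> S" if "u \<in> {0..1}" for u
  proof -
    have "A + u *\<^sub>R (B - A) = (1 - u) *\<^sub>R A + u *\<^sub>R B" by (simp add: algebra_simps)
    then show ?thesis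
      using convex_on_imp_convex[OF conv] assms(2,3) that by (simp add: convex_alt)
  qed
  have "A + ((1 - t) *\<^sub>R x + t *\<^sub>R y) *\<^sub>R (B - A)
      = (1 - t) *\<^sub>R (A + x *\<^sub>R (B - A)) + t *\<^sub>R (A + y *\<^sub>R (B - A))"
    by (simp add: algebra_simps)
  then show "f (A + ((1 - t) *\<^sub>R x + t *\<^sub>R y) *\<^sub>R (B - A))
      \<le> (1 - t) * f (A + x *\<^sub>R (B - A)) + t * f (A + y *\<^sub>R (B - A))"
    using convex_onD[OF conv, of t] t inS[OF xy(1)] inS[OF xy(2)] by simp
qed auto

text \<open>Provides what \<open>has_integral_unit_box_prod2\<close> asks of a factor; the values at
  the two ends give the upper bound.\<close>

lemma convex_on_unit_interval:
  fixes \<phi> :: "real \<Rightarrow> real"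
  assumes "convex_on {0..1} \<phi>"
  shows "continuous_on {0<..<1} \<phi>" "\<phi> absolutely_integrable_on {0<..<1}"
proof -
  have *: "convex_on {0<..<1} \<phi>"
    by (rule convex_on_subset[OF assms]) auto
  then show "continuous_on {0<..<1} \<phi>"
    by (intro convex_on_continuous) auto
  have "convex hull {0, 1} = {0..1::real}"
    by (simp add: closed_segment_eq_real_ivl flip: segment_convex_hull)
  then have "\<phi> t \<le> max (\<phi> 0) (\<phi> 1)" if "t \<in> {0..1}" for t
    using convex_on_convex_hull_bound[of "{0,1}" \<phi> "max (\<phi> 0) (\<phi> 1)"] assms that by auto
  then show "\<phi> absolutely_integrable_on {0<..<1}"
    by (intro convex_on_absolutely_integrable[OF *, of "max (\<phi> 0) (\<phi> 1)"]) auto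
qed

text \<open>The largest value at a vertex bounds a convex function on the whole hull.\<close>

lemma convex_on_polytope_absolutely_integrable:
  fixes f :: "'a::euclidean_space \<Rightarrow> real"
  assumes "finite V" and conv: "convex_on (convex hull V) f"
  shows "f absolutely_integrable_on convex hull V"
proof (rule convex_on_absolutely_integrable[OF conv])
  show "bounded (convex hull V)"
    using assms(1) by (simp add: bounded_convex_hull finite_imp_bounded)
  have "\<forall>x\<in>V. f x \<le> Max (f ` V)" using assms(1) by auto
  then show "f x \<le> Max (f ` V)" if "x \<in> convex hull V" for x
    using convex_on_convex_hull_bound[OF conv] that by blast
qed

section \<open>The inequality on one simplex\<close>

text \<open>The Jacobian weight \<open>s (1 - s)\<close> times the convexity coefficients
  \<open>1 - s\<close> and \<open>s\<close>. The values agree by the symmetry of \<open>s\<close>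
  and \<open>1 - s\<close>, hence the equal weights of the two edges.\<close>

lemma integral_beta_weights:
  "integral {0<..<1} (\<lambda>s::real. s * (1 - s) * (1 - s)) = 1 / 12"
  "integral {0<..<1} (\<lambda>s::real. s * (1 - s) * s) = 1 / 12"
proof -
  have "((\<lambda>s::real. s * (1 - s) * (1 - s)) has_integral
      (1^2 / 2 - 2 * 1^3 / 3 + 1^4 / 4) - (0^2 / 2 - 2 * 0^3 / 3 + 0^4 / 4)) {0..1}"
    by (rule fundamental_theorem_of_calculus)
       (auto simp: has_real_derivative_iff_has_vector_derivative[symmetric] power2_eq_square
         power3_eq_cube algebra_simps intro!: derivative_eq_intros)
  then show "integral {0<..<1} (\<lambda>s::real. s * (1 - s) * (1 - s)) = 1 / 12"
    by (simp add: integral_open_interval_real[symmetric] integral_unique)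
  have "((\<lambda>s::real. s * (1 - s) * s) has_integral
      (1^3 / 3 - 1^4 / 4) - (0^3 / 3 - 0^4 / 4)) {0..1}"
    by (rule fundamental_theorem_of_calculus)
       (auto simp: has_real_derivative_iff_has_vector_derivative[symmetric] power2_eq_square
         power3_eq_cube algebra_simps intro!: derivative_eq_intros)
  then show "integral {0<..<1} (\<lambda>s::real. s * (1 - s) * s) = 1 / 12"
    by (simp add: integral_open_interval_real[symmetric] integral_unique)
qed

text \<open>After the change of variables, convexity bounds the integrand by a sum of two product
  functions. The volume is a sixth of the absolute determinant, so the right-hand side is the volume
  times the mean of the two edge averages.\<close>

lemma convex_integral_simplex_le:
  fixes A B C D :: "real^3" and f :: "real^3 \<Rightarrow> real"
  assumes conv: "convex_on (convex hull {A, B, C, D}) f" and d: "simplex_det A B C D \<noteq> 0"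
  shows "integral (convex hull {A, B, C, D}) f
    \<le> \<bar>simplex_det A B C D\<bar> / 12 * (seg_avg f A B + seg_avg f C D)"
proof -
  define T where "T = convex hull {A, B, C, D}"
  define G where "G = join_map A B C D"
  define \<delta> where "\<delta> = \<bar>simplex_det A B C D\<bar>"
  define \<phi> where "\<phi> t = f (A + t *\<^sub>R (B - A))" for t
  define \<psi> where "\<psi> t = f (C + t *\<^sub>R (D - C))" for t
  have vert: "A \<in> T" "B \<in> T" "C \<in> T" "D \<in> T" by (auto simp: T_def hull_inc)
  have conv: "convex_on T f" using conv by (simp add: T_def)
  have \<phi>c: "convex_on {0..1} \<phi>" and \<psi>c: "convex_on {0..1} \<psi>"
    unfolding \<phi>_def[abs_def] \<psi>_def[abs_def] by (auto intro: convex_on_segment[OF conv] vert)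
  have T: "T = G ` cbox 0 1"
    by (simp add: T_def G_def convex_hull_eq_join_map)
  have sub: "G ` box 0 1 \<subseteq> T"
    using T box_subset_cbox by blast
  \<comment> \<open>A differentiable map between spaces of equal dimension sends null sets to null
    sets, so the open box, where \<open>G\<close> is injective, fills \<open>T\<close> up to a null
    set.\<close>
  have "negligible (G ` (cbox 0 1 - box 0 1))"
  proof (rule negligible_differentiable_image_negligible)
    show "G differentiable_on cbox 0 1 - box 0 1"
      unfolding G_def differentiable_on_def differentiable_def using has_derivative_join_map by blast
    have "cbox 0 1 - box 0 1 = frontier (cbox 0 1 :: (real^3) set)"
      by (simp add: frontier_def)
    then show "negligible (cbox 0 1 - box 0 1 :: (real^3) set)"
      by (simp add: negligible_convex_frontier)
  qed simp
  then have neg: "negligible (T - G ` box 0 1)"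
    by (rule negligible_subset) (auto simp: T)
  have fT: "f absolutely_integrable_on T"
    unfolding T_def by (rule convex_on_polytope_absolutely_integrable) (use conv T_def in auto)
  have neg1: "negligible {x \<in> T - G ` box 0 1. f x \<noteq> 0}"
    by (rule negligible_subset[OF neg]) auto
  have neg2: "negligible {x \<in> G ` box 0 1 - T. f x \<noteq> 0}"
    by (rule negligible_subset[of "{}"]) (use sub in auto)
  have fG: "f absolutely_integrable_on G ` box 0 1"
    using fT absolutely_integrable_spike_set_eq[OF neg1 neg2] by blast
  have inj: "inj_on G (box 0 1)" using inj_on_join_map[OF d] by (simp add: G_def)
  have der: "(G has_derivative join_map_deriv A B C D x) (at x within box 0 1)" for x
    unfolding G_def by (rule has_derivative_join_map)
  have box: "(box 0 1 :: (real^3) set) \<in> sets lebesgue" by simp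
  note cov = change_of_variables_real_valued[OF box der inj fG]
  have w: "continuous_on {0<..<1} w" "w absolutely_integrable_on {0<..<1}"
    if "continuous_on {0..1} w" for w :: "real \<Rightarrow> real"
  proof -
    show "continuous_on {0<..<1} w" by (rule continuous_on_subset[OF that]) auto
    have "w absolutely_integrable_on {0..1}"
      using absolutely_integrable_continuous_real that by blast
    then show "w absolutely_integrable_on {0<..<1}"
      by (rule set_integrable_subset) auto
  qed
  \<comment> \<open>Each half of the upper bound involves only two coordinates, so it
    factorises.\<close>
  have "((\<lambda>x::real^3. x $ 1 * (1 - x $ 1) * (1 - x $ 1) * \<phi> (x $ 2)) has_integral
      integral {0<..<1} (\<lambda>s. s * (1 - s) * (1 - s)) * integral {0<..<1} \<phi>) (box 0 1)"
    by (rule has_integral_unit_box_prod2[OF _ w convex_on_unit_interval[OF \<phi>c]])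
       (auto intro!: continuous_intros)
  moreover have "((\<lambda>x::real^3. x $ 1 * (1 - x $ 1) * x $ 1 * \<psi> (x $ 3)) has_integral
      integral {0<..<1} (\<lambda>s. s * (1 - s) * s) * integral {0<..<1} \<psi>) (box 0 1)"
    by (rule has_integral_unit_box_prod2[OF _ w convex_on_unit_interval[OF \<psi>c]])
       (auto intro!: continuous_intros)
  ultimately have "((\<lambda>x::real^3. \<delta> * (x $ 1 * (1 - x $ 1) * (1 - x $ 1) * \<phi> (x $ 2)
        + x $ 1 * (1 - x $ 1) * x $ 1 * \<psi> (x $ 3)))
      has_integral \<delta> * (1 / 12 * integral {0<..<1} \<phi> + 1 / 12 * integral {0<..<1} \<psi>)) (box 0 1)"
    unfolding integral_beta_weights by (intro has_integral_mult_right has_integral_add)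
  moreover have "integral {0<..<1} \<phi> = seg_avg f A B" "integral {0<..<1} \<psi> = seg_avg f C D"
    by (simp_all add: seg_avg_def \<phi>_def[abs_def] \<psi>_def[abs_def] integral_open_interval_real[symmetric])
  ultimately have hi: "((\<lambda>x::real^3. \<delta> * (x $ 1 * (1 - x $ 1) * (1 - x $ 1) * \<phi> (x $ 2)
        + x $ 1 * (1 - x $ 1) * x $ 1 * \<psi> (x $ 3)))
      has_integral \<delta> / 12 * (seg_avg f A B + seg_avg f C D)) (box 0 1)"
    by (simp add: algebra_simps)
  have "integral T f = integral (G ` box 0 1) f"
    using integral_subset_negligible[OF sub neg, of f] by simp
  also have "\<dots> = integral (box 0 1)
      (\<lambda>x. \<bar>det (matrix (join_map_deriv A B C D x))\<bar> * f (G x))"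
    using cov(2) by simp
  also have "\<dots> \<le> \<delta> / 12 * (seg_avg f A B + seg_avg f C D)"
  proof (rule has_integral_le[OF integrable_integral hi])
    show "(\<lambda>x. \<bar>det (matrix (join_map_deriv A B C D x))\<bar> * f (G x)) integrable_on box 0 1"
      using cov(1) set_lebesgue_integral_eq_integral(1) by blast
    fix x :: "real^3" assume "x \<in> box 0 1"
    then have x: "0 < x $ i" "x $ i < 1" for i by (auto simp: mem_box_cart)
    have in_T: "P + t *\<^sub>R (Q - P) \<in> T" if "P \<in> T" "Q \<in> T" "0 < t" "t < 1" for P Q t
    proof -
      have "P + t *\<^sub>R (Q - P) = (1 - t) *\<^sub>R P + t *\<^sub>R Q" by (simp add: algebra_simps)
      then show ?thesis using that by (simp add: T_def convexD_alt)
    qed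
    \<comment> \<open>Convexity along the segment from the point on \<open>AB\<close> to the point
      on \<open>CD\<close>.\<close>
    have "f (G x) \<le> (1 - x $ 1) * \<phi> (x $ 2) + x $ 1 * \<psi> (x $ 3)"
      unfolding G_def join_map_def \<phi>_def \<psi>_def
      using x by (intro convex_onD[OF conv] in_T vert) (auto intro: less_imp_le)
    then have "\<delta> * (x $ 1 * (1 - x $ 1)) * f (G x)
        \<le> \<delta> * (x $ 1 * (1 - x $ 1)) * ((1 - x $ 1) * \<phi> (x $ 2) + x $ 1 * \<psi> (x $ 3))"
      using x[of 1] by (intro mult_left_mono) (auto simp: \<delta>_def)
    then show "\<bar>det (matrix (join_map_deriv A B C D x))\<bar> * f (G x)
        \<le> \<delta> * (x $ 1 * (1 - x $ 1) * (1 - x $ 1) * \<phi> (x $ 2)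
          + x $ 1 * (1 - x $ 1) * x $ 1 * \<psi> (x $ 3))"
      using x[of 1] by (simp add: det_join_map_deriv abs_mult \<delta>_def[symmetric] algebra_simps)
  qed
  finally show ?thesis by (simp add: T_def \<delta>_def)
qed

text \<open>Relabelling the vertices preserves the hull and changes the determinant at most in sign,
  so one \<delta> serves all three pairs of opposite edges.\<close>

lemma convex_integral_simplex_opposite_edges:
  fixes A B C D :: "real^3" and f :: "real^3 \<Rightarrow> real"
  assumes conv: "convex_on (convex hull {A, B, C, D}) f"
    and \<delta>: "\<bar>simplex_det A B C D\<bar> = \<delta>" "\<delta> \<noteq> 0"
  shows "integral (convex hull {A, B, C, D}) f \<le> \<delta> / 12 * (seg_avg f A B + seg_avg f C D)"
    and "integral (convex hull {A, B, C, D}) f \<le> \<delta> / 12 * (seg_avg f A C + seg_avg f B D)"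
    and "integral (convex hull {A, B, C, D}) f \<le> \<delta> / 12 * (seg_avg f A D + seg_avg f B C)"
proof -
  have "simplex_det A C B D = - simplex_det A B C D" "simplex_det A D B C = simplex_det A B C D"
    unfolding det_3 vector_3 by algebra+
  then have "\<bar>simplex_det A C B D\<bar> = \<delta>" "\<bar>simplex_det A D B C\<bar> = \<delta>" using \<delta> by auto
  moreover have "{A, C, B, D} = {A, B, C, D}" "{A, D, B, C} = {A, B, C, D}" by auto
  ultimately show "integral (convex hull {A, B, C, D}) f \<le> \<delta> / 12 * (seg_avg f A B + seg_avg f C D)"
    and "integral (convex hull {A, B, C, D}) f \<le> \<delta> / 12 * (seg_avg f A C + seg_avg f B D)"
    and "integral (convex hull {A, B, C, D}) f \<le> \<delta> / 12 * (seg_avg f A D + seg_avg f B C)"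
    using convex_integral_simplex_le[of A B C D f] convex_integral_simplex_le[of A C B D f]
      convex_integral_simplex_le[of A D B C f] conv \<delta> by auto
qed

subsection \<open>The diagonal split of the cube\<close>

text \<open>Even indices are the neighbours of \<open>a\<close>, odd ones those of the opposite
  vertex; each step round the cycle adds or removes one edge vector. The \<open>mod\<close> closes
  the cycle.\<close>

definition cube_vertex :: "real^3 \<Rightarrow> real^3 \<Rightarrow> real^3 \<Rightarrow> real^3 \<Rightarrow> nat \<Rightarrow> real^3" where
  "cube_vertex a e1 e2 e3 k =
     [a + e1, a + e1 + e2, a + e2, a + e2 + e3, a + e3, a + e1 + e3] ! (k mod 6)"

text \<open>In a cube, each \<open>k < 6\<close> corresponds to one weak ordering of the three
  coordinates along \<open>e1\<close>, \<open>e2\<close>, \<open>e3\<close>.\<close>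

definition diag_simplex :: "real^3 \<Rightarrow> real^3 \<Rightarrow> real^3 \<Rightarrow> real^3 \<Rightarrow> nat \<Rightarrow> (real^3) set" where
  "diag_simplex a e1 e2 e3 k =
     convex hull {a, a + e1 + e2 + e3, cube_vertex a e1 e2 e3 k, cube_vertex a e1 e2 e3 (Suc k)}"

lemma cube_vertex_simps [simp]:
  "cube_vertex a e1 e2 e3 0 = a + e1"
  "cube_vertex a e1 e2 e3 1 = a + e1 + e2"
  "cube_vertex a e1 e2 e3 (Suc 0) = a + e1 + e2"
  "cube_vertex a e1 e2 e3 2 = a + e2"
  "cube_vertex a e1 e2 e3 (Suc (Suc 0)) = a + e2"
  "cube_vertex a e1 e2 e3 3 = a + e2 + e3"
  "cube_vertex a e1 e2 e3 4 = a + e3"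
  "cube_vertex a e1 e2 e3 5 = a + e1 + e3"
  "cube_vertex a e1 e2 e3 6 = a + e1"
  by (simp_all add: cube_vertex_def)

lemma less_6_cases:
  assumes "k < (6::nat)"
  obtains "k = 0" | "k = 1" | "k = 2" | "k = 3" | "k = 4" | "k = 5"
  using assms by linarith

text \<open>Equal volumes: going round the cycle even preserves the sign of the determinant. This
  allows an unweighted average over the six simplices.\<close>

lemma abs_det_diag_simplex:
  assumes "k < 6"
  shows "\<bar>simplex_det a (a + e1 + e2 + e3) (cube_vertex a e1 e2 e3 k) (cube_vertex a e1 e2 e3 (Suc k))\<bar>
    = \<bar>det (vector [e1, e2, e3] :: real^3^3)\<bar>"
proof -
  define d where "d = det (vector [e1, e2, e3] :: real^3^3)"
  from assms have "simplex_det a (a + e1 + e2 + e3) (cube_vertex a e1 e2 e3 k) (cube_vertex a e1 e2 e3 (Suc k))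
    = d"
    by (cases rule: less_6_cases) (simp_all add: d_def det_3 algebra_simps)
  then show ?thesis by (simp add: d_def)
qed

text \<open>As a translated linear image of the unit box, the cube inherits convexity and gets its
  volume from a determinant.\<close>

lemma cube_set_eq_image:
  "cube_set a e1 e2 e3 = (+) a ` (\<lambda>x::real^3. x $ 1 *\<^sub>R e1 + x $ 2 *\<^sub>R e2 + x $ 3 *\<^sub>R e3) ` cbox 0 1"
  (is "?L = ?R")
proof
  show "?L \<subseteq> ?R"
  proof
    fix p assume "p \<in> ?L"
    then obtain x1 x2 x3 where p: "p = a + x1 *\<^sub>R e1 + x2 *\<^sub>R e2 + x3 *\<^sub>R e3"
      "x1 \<in> {0..1}" "x2 \<in> {0..1}" "x3 \<in> {0..1}"
      unfolding cube_set_def by blast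
    have "vector [x1, x2, x3] \<in> (cbox 0 1 :: (real^3) set)"
      using p by (auto simp: mem_box_cart forall_3)
    then show "p \<in> ?R"
      unfolding image_image by (rule rev_image_eqI) (simp add: p add.assoc)
  qed
  show "?R \<subseteq> ?L"
    unfolding image_image cube_set_def by (fastforce simp: mem_box_cart add.assoc)
qed

lemma linear_edge_combination:
  "linear (\<lambda>x::real^3. x $ 1 *\<^sub>R e1 + x $ 2 *\<^sub>R e2 + x $ 3 *\<^sub>R (e3::'a::real_vector))"
  by (rule linearI) (simp_all add: algebra_simps)

lemma convex_cube_set: "convex (cube_set a e1 e2 e3)"
  unfolding cube_set_eq_image
  by (intro convex_translation convex_linear_image linear_edge_combination convex_box)

lemma measure_cube_set:
  "measure lebesgue (cube_set a e1 e2 e3) = \<bar>det (vector [e1, e2, e3] :: real^3^3)\<bar>"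
proof -
  have "matrix (\<lambda>x. x $ 1 *\<^sub>R e1 + x $ 2 *\<^sub>R e2 + x $ 3 *\<^sub>R e3) = transpose (vector [e1, e2, e3] :: real^3^3)"
    by (simp add: matrix_def transpose_def vec_eq_iff forall_3 axis_def)
  moreover have "measure lebesgue (cbox 0 1 :: (real^3) set) = 1"
    by (simp add: content_cbox_cart interval_ne_empty_cart)
  ultimately show ?thesis
    unfolding cube_set_eq_image measure_translation
    by (subst measure_linear_image[OF linear_edge_combination]) (simp_all add: det_transpose)
qed

text \<open>For sorted coordinates, \<open>1 - x\<close>, \<open>x - y\<close>,
  \<open>y - z\<close>, \<open>z\<close> are barycentric coordinates with respect to the path
  \<open>a\<close>, \<open>a + p\<close>, \<open>a + p + q\<close>,
  \<open>a + p + q + r\<close>.\<close>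

lemma order_simplex_subset:
  fixes a p q r :: "'a::real_vector"
  assumes S: "convex S" "a \<in> S" "a + p \<in> S" "a + p + q \<in> S" "a + p + q + r \<in> S"
    and xyz: "x \<le> 1" "y \<le> x" "z \<le> y" "0 \<le> z"
  shows "a + x *\<^sub>R p + y *\<^sub>R q + z *\<^sub>R r \<in> S"
proof -
  define c where "c i = [1 - x, x - y, y - z, z] ! i" for i
  define v where "v i = [a, a + p, a + p + q, a + p + q + r] ! i" for i
  have 4: "{..<4} = {0, 1, 2, 3::nat}" by auto
  have "(\<Sum>i<4. c i *\<^sub>R v i) \<in> S"
    using S xyz by (intro convex_sum) (auto simp: c_def v_def 4)
  moreover have "(\<Sum>i<4. c i *\<^sub>R v i) = a + x *\<^sub>R p + y *\<^sub>R q + z *\<^sub>R r"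
    by (simp add: 4 c_def v_def algebra_simps)
  ultimately show ?thesis by simp
qed

lemma cube_eq_Union_diag_simplex:
  "cube_set a e1 e2 e3 = (\<Union>k<6. diag_simplex a e1 e2 e3 k)"
proof
  show "(\<Union>k<6. diag_simplex a e1 e2 e3 k) \<subseteq> cube_set a e1 e2 e3"
  proof (rule UN_least)
    fix k :: nat
    have c: "a + x1 *\<^sub>R e1 + x2 *\<^sub>R e2 + x3 *\<^sub>R e3 \<in> cube_set a e1 e2 e3"
      if "x1 \<in> {0..1}" "x2 \<in> {0..1}" "x3 \<in> {0..1}" for x1 x2 x3
      using that unfolding cube_set_def by blast
    note c = c[of 0 0 0] c[of 1 1 1] c[of 1 0 0] c[of 0 1 0] c[of 0 0 1]
      c[of 1 1 0] c[of 1 0 1] c[of 0 1 1]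
    have "cube_vertex a e1 e2 e3 j \<in> cube_set a e1 e2 e3" for j
    proof -
      have "j mod 6 < 6" by simp
      then show ?thesis
        unfolding cube_vertex_def by (cases rule: less_6_cases) (use c in simp_all)
    qed
    then show "diag_simplex a e1 e2 e3 k \<subseteq> cube_set a e1 e2 e3"
      unfolding diag_simplex_def using c by (intro hull_minimal convex_cube_set) simp
  qed
  show "cube_set a e1 e2 e3 \<subseteq> (\<Union>k<6. diag_simplex a e1 e2 e3 k)"
  proof
    fix p assume "p \<in> cube_set a e1 e2 e3"
    then obtain x1 x2 x3 where p: "p = a + x1 *\<^sub>R e1 + x2 *\<^sub>R e2 + x3 *\<^sub>R e3"
      "0 \<le> x1" "x1 \<le> 1" "0 \<le> x2" "x2 \<le> 1" "0 \<le> x3" "x3 \<le> 1"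
      unfolding cube_set_def by auto
    have cv: "convex (diag_simplex a e1 e2 e3 k)" for k
      by (simp add: diag_simplex_def)
    have v: "a \<in> diag_simplex a e1 e2 e3 k" "a + e1 + e2 + e3 \<in> diag_simplex a e1 e2 e3 k"
      "cube_vertex a e1 e2 e3 k \<in> diag_simplex a e1 e2 e3 k"
      "cube_vertex a e1 e2 e3 (Suc k) \<in> diag_simplex a e1 e2 e3 k" for k
      by (simp_all add: diag_simplex_def hull_inc)
    \<comment> \<open>The six orderings, listed in the order of \<open>k\<close>; the decreasing
      order of the coordinates gives the edge path from \<open>a\<close> to the opposite
      vertex.\<close>
    consider "x2 \<le> x1" "x3 \<le> x2" | "x1 \<le> x2" "x3 \<le> x1" | "x3 \<le> x2" "x1 \<le> x3"
      | "x2 \<le> x3" "x1 \<le> x2" | "x1 \<le> x3" "x2 \<le> x1" | "x3 \<le> x1" "x2 \<le> x3"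
      by linarith
    then have "\<exists>k<6. p \<in> diag_simplex a e1 e2 e3 k"
    proof cases
      case 1
      with p have "p \<in> diag_simplex a e1 e2 e3 0"
        using order_simplex_subset[OF cv[of 0], of a e1 e2 e3 x1 x2 x3] v[of 0]
        by (simp add: algebra_simps)
      then show ?thesis by (intro exI[of _ 0]) simp
    next
      case 2
      with p have "p \<in> diag_simplex a e1 e2 e3 1"
        using order_simplex_subset[OF cv[of 1], of a e2 e1 e3 x2 x1 x3] v[of 1]
        by (simp add: algebra_simps)
      then show ?thesis by (intro exI[of _ 1]) simp
    next
      case 3
      with p have "p \<in> diag_simplex a e1 e2 e3 2"
        using order_simplex_subset[OF cv[of 2], of a e2 e3 e1 x2 x3 x1] v[of 2]
        by (simp add: algebra_simps)
      then show ?thesis by (intro exI[of _ 2]) simp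
    next
      case 4
      with p have "p \<in> diag_simplex a e1 e2 e3 3"
        using order_simplex_subset[OF cv[of 3], of a e3 e2 e1 x3 x2 x1] v[of 3]
        by (simp add: algebra_simps)
      then show ?thesis by (intro exI[of _ 3]) simp
    next
      case 5
      with p have "p \<in> diag_simplex a e1 e2 e3 4"
        using order_simplex_subset[OF cv[of 4], of a e3 e1 e2 x3 x1 x2] v[of 4]
        by (simp add: algebra_simps)
      then show ?thesis by (intro exI[of _ 4]) simp
    next
      case 6
      with p have "p \<in> diag_simplex a e1 e2 e3 5"
        using order_simplex_subset[OF cv[of 5], of a e1 e3 e2 x1 x3 x2] v[of 5]
        by (simp add: algebra_simps)
      then show ?thesis by (intro exI[of _ 5]) simp
    qed
    then show "p \<in> (\<Union>k<6. diag_simplex a e1 e2 e3 k)" by auto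
  qed
qed

text \<open>Distinct simplices can share only points with two equal coordinates. Orthogonality and
  equal lengths make the products \<open>c e1 p\<close>, \<open>c e2 p\<close>,
  \<open>c e3 p\<close> a common positive multiple of the cube coordinates, so comparing them
  compares coordinates.\<close>

lemma negligible_Int_diag_simplex:
  fixes a e1 e2 e3 :: "real^3"
  assumes orth: "e1 \<bullet> e2 = 0" "e1 \<bullet> e3 = 0" "e2 \<bullet> e3 = 0"
    and eqlen: "norm e1 = norm e2" "norm e2 = norm e3"
    and nz: "e1 \<noteq> 0"
    and "k < 6" "l < 6" "k \<noteq> l"
  shows "negligible (diag_simplex a e1 e2 e3 k \<inter> diag_simplex a e1 e2 e3 l)"
proof -
  have sq: "e2 \<bullet> e2 = e1 \<bullet> e1" "e3 \<bullet> e3 = e1 \<bullet> e1"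
    using eqlen by (simp_all flip: power2_norm_eq_inner)
  have neq: "e1 \<noteq> e2" "e1 \<noteq> e3" "e2 \<noteq> e3"
    using orth nz sq by (metis inner_eq_zero_iff)+
  define c where "c e p = (p - a) \<bullet> e" for e p
  define N where "N = {p. c e1 p = c e2 p} \<union> {p. c e1 p = c e3 p} \<union> {p. c e2 p = c e3 p}"
  have "negligible {p. c e p = c e' p}" if "e \<noteq> e'" for e e'
  proof -
    have "{p. c e p = c e' p} = {p. (e - e') \<bullet> p = (e - e') \<bullet> a}"
      by (auto simp: c_def inner_diff_left inner_diff_right inner_commute)
    then show ?thesis using that by (simp add: negligible_hyperplane)
  qed
  then have N: "negligible N" using neq by (simp add: N_def)
  \<comment> \<open>A half-space is convex, so checking the vertices suffices; at \<open>a\<close>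
    both sides vanish.\<close>
  have hs: "diag_simplex a e1 e2 e3 k \<subseteq> {p. c e p \<le> c e' p}"
    if "c e (cube_vertex a e1 e2 e3 k) \<le> c e' (cube_vertex a e1 e2 e3 k)"
      "c e (cube_vertex a e1 e2 e3 (Suc k)) \<le> c e' (cube_vertex a e1 e2 e3 (Suc k))"
      "c e (a + e1 + e2 + e3) \<le> c e' (a + e1 + e2 + e3)" for e e' k
  proof -
    have "{p. c e p \<le> c e' p} = {p. (e - e') \<bullet> p \<le> (e - e') \<bullet> a}"
      by (auto simp: c_def inner_diff_left inner_diff_right inner_commute)
    then have "convex {p. c e p \<le> c e' p}" by (simp add: convex_halfspace_le)
    then show ?thesis
      unfolding diag_simplex_def using that by (intro hull_minimal) (auto simp: c_def)
  qed
  have eval_c: "c e a = 0" "c e (a + x) = x \<bullet> e" "c e (a + x + y) = x \<bullet> e + y \<bullet> e"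
    "c e (a + x + y + z) = x \<bullet> e + y \<bullet> e + z \<bullet> e" for e x y z
    by (simp_all add: c_def inner_add_left inner_diff_left)
  note dots = sq orth orth[unfolded inner_commute[of e1] inner_commute[of e2 e3]]
  \<comment> \<open>Off the hyperplanes \<open>N\<close>, the order of the three coordinates determines the simplex.\<close>
  define \<kappa> where "\<kappa> p = (if c e2 p < c e1 p
      then (if c e3 p < c e2 p then 0 else if c e3 p < c e1 p then 5 else 4)
      else (if c e3 p < c e1 p then 1 else if c e3 p < c e2 p then 2 else (3::nat)))" for p
  have \<kappa>: "k = \<kappa> p" if "k < 6" "p \<in> diag_simplex a e1 e2 e3 k" "p \<notin> N" for k p
  proof -
    from that(1) show ?thesis
    proof (cases rule: less_6_cases)
      case 1
      then have "c e2 p \<le> c e1 p" "c e3 p \<le> c e2 p"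
        using that hs[where k=0 and e=e2 and e'=e1] hs[where k=0 and e=e3 and e'=e2]
        by (auto simp: eval_c dots)
      then show ?thesis using \<open>k = 0\<close> that(3) by (auto simp: \<kappa>_def N_def)
    next
      case 2
      then have "c e1 p \<le> c e2 p" "c e3 p \<le> c e1 p"
        using that hs[where k=1 and e=e1 and e'=e2] hs[where k=1 and e=e3 and e'=e1]
        by (auto simp: eval_c dots)
      then show ?thesis using \<open>k = 1\<close> that(3) by (auto simp: \<kappa>_def N_def)
    next
      case 3
      then have "c e3 p \<le> c e2 p" "c e1 p \<le> c e3 p"
        using that hs[where k=2 and e=e3 and e'=e2] hs[where k=2 and e=e1 and e'=e3]
        by (auto simp: eval_c dots)
      then show ?thesis using \<open>k = 2\<close> that(3) by (auto simp: \<kappa>_def N_def)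
    next
      case 4
      then have "c e2 p \<le> c e3 p" "c e1 p \<le> c e2 p"
        using that hs[where k=3 and e=e2 and e'=e3] hs[where k=3 and e=e1 and e'=e2]
        by (auto simp: eval_c dots)
      then show ?thesis using \<open>k = 3\<close> that(3) by (auto simp: \<kappa>_def N_def)
    next
      case 5
      then have "c e1 p \<le> c e3 p" "c e2 p \<le> c e1 p"
        using that hs[where k=4 and e=e1 and e'=e3] hs[where k=4 and e=e2 and e'=e1]
        by (auto simp: eval_c dots)
      then show ?thesis using \<open>k = 4\<close> that(3) by (auto simp: \<kappa>_def N_def)
    next
      case 6
      then have "c e3 p \<le> c e1 p" "c e2 p \<le> c e3 p"
        using that hs[where k=5 and e=e3 and e'=e1] hs[where k=5 and e=e2 and e'=e3]
        by (auto simp: eval_c dots)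
      then show ?thesis using \<open>k = 5\<close> that(3) by (auto simp: \<kappa>_def N_def)
    qed
  qed
  have "diag_simplex a e1 e2 e3 k \<inter> diag_simplex a e1 e2 e3 l \<subseteq> N"
    using \<kappa>[OF \<open>k < 6\<close>] \<kappa>[OF \<open>l < 6\<close>] \<open>k \<noteq> l\<close> by blast
  then show ?thesis using N negligible_subset by blast
qed

section \<open>Averaging over the six simplices\<close>

text \<open>A common length cancels from the weighted mean; used with the edge length for
  \<open>L\<close> and \<open>S\<close> and the face diagonal length for \<open>P\<close>.\<close>

lemma union_avg_equal_lengths:
  assumes "\<And>p q. (p, q) \<in> set segs \<Longrightarrow> dist p q = l" and "l \<noteq> 0"
  shows "union_avg f segs = (\<Sum>(p, q)\<leftarrow>segs. seg_avg f p q) / length segs"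
proof -
  have "(\<Sum>(p, q)\<leftarrow>segs. dist p q * seg_avg f p q) = l * (\<Sum>(p, q)\<leftarrow>segs. seg_avg f p q)"
    using assms(1) by (induction segs) (auto simp: algebra_simps)
  moreover have "(\<Sum>(p, q)\<leftarrow>segs. dist p q) = l * length segs"
    using assms(1) by (induction segs) (auto simp: algebra_simps)
  ultimately show ?thesis using assms(2) by (simp add: union_avg_def)
qed

text \<open>The Gram matrix is diagonal with the squared lengths as entries, and its determinant is
  the square of the one in question.\<close>

lemma det_orthogonal_nonzero:
  fixes e1 e2 e3 :: "real^3"
  assumes orth: "e1 \<bullet> e2 = 0" "e1 \<bullet> e3 = 0" "e2 \<bullet> e3 = 0"
    and nz: "e1 \<noteq> 0" "e2 \<noteq> 0" "e3 \<noteq> 0"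
  shows "det (vector [e1, e2, e3] :: real^3^3) \<noteq> 0"
proof -
  define M where "M = (vector [e1, e2, e3] :: real^3^3)"
  have rows: "M $ 1 = e1" "M $ 2 = e2" "M $ 3 = e3" by (simp_all add: M_def)
  have "(M ** transpose M) $ i $ j = M $ i \<bullet> M $ j" for i j
    by (simp add: matrix_matrix_mult_def transpose_def inner_vec_def)
  then have "det (M ** transpose M) = (e1 \<bullet> e1) * (e2 \<bullet> e2) * (e3 \<bullet> e3)"
    using orth by (simp add: det_3 rows inner_commute)
  then have "det M * det M \<noteq> 0"
    using nz by (simp add: det_mul det_transpose)
  then show ?thesis by (simp add: M_def)
qed

theorem theorem8p3:
  fixes a e1 e2 e3 :: "real^3" and f :: "real^3 \<Rightarrow> real"
    and O1 O2 :: "real^3" and V :: "nat \<Rightarrow> real^3" and C :: "(real^3) set"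
  assumes orth: "e1 \<bullet> e2 = 0" "e1 \<bullet> e3 = 0" "e2 \<bullet> e3 = 0"
    and eqlen: "norm e1 = norm e2" "norm e2 = norm e3"
    and nz: "e1 \<noteq> 0"
  defines "C \<equiv> cube_set a e1 e2 e3"
    and "O1 \<equiv> a"
    and "O2 \<equiv> a + e1 + e2 + e3"
    and "V \<equiv> (\<lambda>k. [a + e1, a + e1 + e2, a + e2, a + e2 + e3, a + e3, a + e1 + e3] ! (k mod 6))"
  assumes conv: "\<forall>k<6. convex_on (convex hull {O1, O2, V k, V (Suc k)}) f"
  shows "vol_avg f C \<le> 1/2 * seg_avg f O1 O2 + 1/2 * union_avg f (map (\<lambda>k. (V k, V (Suc k))) [0..<6]) \<and>
         vol_avg f C \<le> union_avg f [(O1, V 1), (O1, V 3), (O1, V 5), (O2, V 0), (O2, V 2), (O2, V 4)] \<and>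
         vol_avg f C \<le> union_avg f [(O1, V 0), (O1, V 2), (O1, V 4), (O2, V 1), (O2, V 3), (O2, V 5)]"
proof -
  define \<delta> where "\<delta> = \<bar>det (vector [e1, e2, e3] :: real^3^3)\<bar>"
  define I where "I k = integral (diag_simplex a e1 e2 e3 k) f" for k
  have V: "V = cube_vertex a e1 e2 e3"
    by (simp add: V_def cube_vertex_def fun_eq_iff)
  have nz': "e2 \<noteq> 0" "e3 \<noteq> 0" using nz eqlen by auto
  have \<delta>: "\<delta> > 0"
    using det_orthogonal_nonzero[OF orth nz nz'] by (simp add: \<delta>_def)
  have conv': "convex_on (convex hull {a, a + e1 + e2 + e3, V k, V (Suc k)}) f" if "k < 6" for k
    using conv that unfolding O1_def O2_def by blast
  \<comment> \<open>The three pairs of opposite edges of the \<open>k\<close>-th simplex. Which of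
    the last two pairs belongs to \<open>P\<close> and which to \<open>S\<close> depends on the
    parity of \<open>k\<close>.\<close>
  have edges: "I k \<le> \<delta> / 12 * (seg_avg f O1 O2 + seg_avg f (V k) (V (Suc k)))"
    "I k \<le> \<delta> / 12 * (seg_avg f O1 (V k) + seg_avg f O2 (V (Suc k)))"
    "I k \<le> \<delta> / 12 * (seg_avg f O1 (V (Suc k)) + seg_avg f O2 (V k))" if "k < 6" for k
    using convex_integral_simplex_opposite_edges[OF conv'[OF that], of \<delta>]
      abs_det_diag_simplex[OF that, of a e1 e2 e3] \<delta>
    by (simp_all add: I_def diag_simplex_def V O1_def O2_def \<delta>_def)
  \<comment> \<open>Convexity is given on each simplex only, so integrability on the cube is
    assembled from the pieces, which overlap in null sets.\<close>
  have "(f has_integral (\<Sum>k<6. I k)) (\<Union>k<6. diag_simplex a e1 e2 e3 k)"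
  proof (rule has_integral_UN)
    fix k :: nat assume "k \<in> {..<6}"
    then have "f absolutely_integrable_on diag_simplex a e1 e2 e3 k"
      unfolding diag_simplex_def
      using convex_on_polytope_absolutely_integrable[OF _ conv'[of k]] by (simp add: V)
    then show "(f has_integral I k) (diag_simplex a e1 e2 e3 k)"
      unfolding I_def using set_lebesgue_integral_eq_integral(1) integrable_integral by blast
  next
    show "pairwise (\<lambda>k l. negligible (diag_simplex a e1 e2 e3 k \<inter> diag_simplex a e1 e2 e3 l)) {..<6}"
      using negligible_Int_diag_simplex[OF orth eqlen nz] by (simp add: pairwise_def)
  qed simp
  then have "integral C f = (\<Sum>k<6. I k)"
    unfolding C_def cube_eq_Union_diag_simplex by (rule integral_unique)
  then have vol: "vol_avg f C = (\<Sum>k<6. I k) / \<delta>"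
    by (simp add: vol_avg_def C_def measure_cube_set \<delta>_def)
  \<comment> \<open>For \<open>k = 5\<close> the successor index wraps round.\<close>
  have V6: "V 6 = V 0" by (simp add: V)
  have six: "{..<6} = {0, 1, 2, 3, 4, 5::nat}" by auto
  \<comment> \<open>The 12 is six simplices times two opposite edges; the volume \<delta>
    cancels.\<close>
  have bound: "vol_avg f C \<le> (\<Sum>k<6. s k) / 12" if "\<And>k. k < 6 \<Longrightarrow> I k \<le> \<delta> / 12 * s k" for s
  proof -
    have "(\<Sum>k<6. I k) \<le> (\<Sum>k<6. \<delta> / 12 * s k)" by (intro sum_mono that) simp
    then have "(\<Sum>k<6. I k) \<le> \<delta> / 12 * (\<Sum>k<6. s k)" by (simp only: sum_distrib_left)
    then show ?thesis using \<delta> by (simp add: vol field_simps)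
  qed
  have sq: "e2 \<bullet> e2 = e1 \<bullet> e1" "e3 \<bullet> e3 = e1 \<bullet> e1"
    using eqlen by (simp_all flip: power2_norm_eq_inner)
  note dots = sq orth orth[unfolded inner_commute[of e1] inner_commute[of e2 e3]]
  define l where "l = norm e1"
  have l: "l > 0" using nz by (simp add: l_def)
  have edge_length: "dist (V k) (V (Suc k)) = l" if "k < 6" for k
    using that eqlen by (cases rule: less_6_cases) (simp_all add: V l_def dist_norm)
  have L: "union_avg f (map (\<lambda>k. (V k, V (Suc k))) [0..<6])
      = (\<Sum>k<6. seg_avg f (V k) (V (Suc k))) / 6"
    using edge_length l
    by (subst union_avg_equal_lengths[where l=l])
       (auto simp: o_def interv_sum_list_conv_sum_set_nat atLeast0LessThan)
  have diag: "norm (x + y) = sqrt 2 * l" if "x \<bullet> y = 0" "x \<bullet> x = e1 \<bullet> e1" "y \<bullet> y = e1 \<bullet> e1"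
    for x y :: "real^3"
    using that by (simp add: norm_eq_sqrt_inner inner_add_left inner_add_right inner_commute
        real_sqrt_mult[symmetric] l_def)
  have P: "union_avg f [(O1, V 1), (O1, V 3), (O1, V 5), (O2, V 0), (O2, V 2), (O2, V 4)]
      = (seg_avg f O1 (V 1) + seg_avg f O1 (V 3) + seg_avg f O1 (V 5)
        + seg_avg f O2 (V 0) + seg_avg f O2 (V 2) + seg_avg f O2 (V 4)) / 6"
    using diag[of e1 e2] diag[of e2 e3] diag[of e1 e3] l
    by (subst union_avg_equal_lengths[where l="sqrt 2 * l"])
       (auto simp: V O1_def O2_def dist_norm dots norm_minus_commute add.assoc algebra_simps)
  have S: "union_avg f [(O1, V 0), (O1, V 2), (O1, V 4), (O2, V 1), (O2, V 3), (O2, V 5)]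
      = (seg_avg f O1 (V 0) + seg_avg f O1 (V 2) + seg_avg f O1 (V 4)
        + seg_avg f O2 (V 1) + seg_avg f O2 (V 3) + seg_avg f O2 (V 5)) / 6"
    using eqlen l
    by (subst union_avg_equal_lengths[where l=l])
       (auto simp: V O1_def O2_def dist_norm l_def)
  \<comment> \<open>The diagonal occurs in all six simplices, each edge of \<open>L\<close> in
    one.\<close>
  have "vol_avg f C \<le> (\<Sum>k<6. seg_avg f O1 O2 + seg_avg f (V k) (V (Suc k))) / 12"
    by (rule bound) (rule edges)
  then have 1: "vol_avg f C \<le> 1/2 * seg_avg f O1 O2
      + 1/2 * union_avg f (map (\<lambda>k. (V k, V (Suc k))) [0..<6])"
    by (simp add: L sum.distrib add_divide_distrib)
  \<comment> \<open>\<open>O1\<close> sees odd vertices, and \<open>O2\<close> even ones, along face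
    diagonals, so parity picks the pair in \<open>P\<close>. Each segment then occurs twice, turning
    1/12 into 1/6.\<close>
  have "vol_avg f C \<le> (\<Sum>k<6. if even k then seg_avg f O1 (V (Suc k)) + seg_avg f O2 (V k)
      else seg_avg f O1 (V k) + seg_avg f O2 (V (Suc k))) / 12"
    by (rule bound) (use edges in auto)
  then have 2: "vol_avg f C
      \<le> union_avg f [(O1, V 1), (O1, V 3), (O1, V 5), (O2, V 0), (O2, V 2), (O2, V 4)]"
    unfolding P by (simp add: six V6 numeral_2_eq_2[symmetric])
  \<comment> \<open>The complementary choice picks the two cube edges, again each counted
    twice.\<close>
  have "vol_avg f C \<le> (\<Sum>k<6. if even k then seg_avg f O1 (V k) + seg_avg f O2 (V (Suc k))
      else seg_avg f O1 (V (Suc k)) + seg_avg f O2 (V k)) / 12"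
    by (rule bound) (use edges in auto)
  then have 3: "vol_avg f C
      \<le> union_avg f [(O1, V 0), (O1, V 2), (O1, V 4), (O2, V 1), (O2, V 3), (O2, V 5)]"
    unfolding S by (simp add: six V6 numeral_2_eq_2[symmetric])
  show ?thesis using 1 2 3 by blast
qed

end
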